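(* Let $\mathfrak{X}$ be a real linear space with an infinite countable Hamel basis $(e_n)_{n\in\mathbb{N}}$ and let $\mathfrak{D}\subseteq\mathfrak{X}$ satisfy: ($\mathfrak{D}1$) for all $n\in\mathbb{N}$, $\mathfrak{D}\cap\langle (e_i)_{i\ge n}\rangle\neq\emptyset$; ($\mathfrak{D}2$) for all $n\in\mathbb{N}$, the set $\mathfrak{D}\cap\langle (e_i)_{i<n}\rangle$ is finite. Let $\mathcal{G}\subseteq\mathcal{B}_{\mathfrak{D}}^\infty$ be an analytic subset of $\mathfrak{D}^{\mathbb{N}}$. Then for every $U\in\mathcal{B}_{\mathfrak{D}}^\infty$ there exists $Z\in\mathcal{B}_{\mathfrak{D}}^\infty(U)$ such that either $\mathcal{B}_{\mathfrak{D}}^\infty(Z)\cap\mathcal{G}=\emptyset$ or player II has a winning strategy in the game $G_{\mathfrak{D}}(Z)$ for $\mathcal{G}$.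
   Context: $\langle A\rangle$ denotes the linear span of $A$. For $x=\sum_n\lambda_ne_n$, $\mathrm{supp}\,x=\{n:\lambda_n\ne0\}$. For nonzero $x,y$, $x<y$ means $\max\mathrm{supp}\,x<\min\mathrm{supp}\,y$. A block sequence is a sequence $(x_n)_n$ of nonzero vectors with $x_n<x_{n+1}$ for all $n$. A block sequence $Y=(y_n)_n$ is a block subsequence of $Z=(z_n)_n$ (written $Y\preceq Z$) if $y_n\in\langle (z_i)_i\rangle$ for all $n$. $\mathcal{B}_{\mathfrak{D}}^\infty$ is the set of all infinite block sequences $(x_n)_n$ with $x_n\in\mathfrak{D}$ for all $n$, and $\mathcal{B}_{\mathfrak{D}}^\infty(Z)=\{Y\in\mathcal{B}_{\mathfrak{D}}^\infty:Y\preceq Z\}$. By ($\mathfrak{D}2$), $\mathfrak{D}$ is countable; it is given the discrete topology and $\mathfrak{D}^{\mathbb{N}}$ the product topology, so $\mathfrak{D}^{\mathbb{N}}$ is Polish. A subset of a Polish space is analytic if it is a continuous image of the Baire space $\mathbb{N}^{\mathbb{N}}$ (the empty set is also regarded as analytic). The $\mathfrak{D}$-Gowers' game $G_{\mathfrak{D}}(Z)$, for $Z\in\mathcal{B}_{\mathfrak{D}}^\infty$: player I chooses $W_0\in\mathcal{B}_{\mathfrak{D}}^\infty(Z)$ and player II responds with a vector $w_0\in\langle W_0\rangle\cap\mathfrak{D}$; then player I chooses $W_1\in\mathcal{B}_{\mathfrak{D}}^\infty(Z)$ and player II chooses $w_1\in\langle W_1\rangle\cap\mathfrak{D}$, and so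 on. Player II wins the game for $\mathcal{G}$ if the sequence $(w_0,w_1,\dots)$ belongs to $\mathcal{G}$. *)

theory Defs
  imports "HOL-Analysis.Analysis"
begin

definition baire_space :: "(nat \<Rightarrow> nat) topology" where
  "baire_space = product_topology (\<lambda>_. discrete_topology UNIV) UNIV"

text \<open>Meant for Polish spaces \<open>X\<close>.\<close>

definition analytic_in :: "'a topology \<Rightarrow> 'a set \<Rightarrow> bool" where
  "analytic_in X A \<longleftrightarrow>
     A = {} \<or> (\<exists>f. continuous_map baire_space X f \<and> f ` topspace baire_space = A)"

definition seq_topology :: "'a set \<Rightarrow> (nat \<Rightarrow> 'a) topology" where
  "seq_topology D = product_topology (\<lambda>_. discrete_topology D) UNIV"

text \<open>
  Throughout, \<open>e\<close> is an injective enumeration of a Hamel basis of the whole type \<open>'a\<close>;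
  then \<open>representation (range e) x (e n)\<close> is the \<open>n\<close>-th coordinate of \<open>x\<close>, and
  \<open>vsupp e x\<close> is finite, and nonempty exactly when \<open>x \<noteq> 0\<close>.
\<close>

definition vsupp :: "(nat \<Rightarrow> 'a::real_vector) \<Rightarrow> 'a \<Rightarrow> nat set" where
  "vsupp e x = {n. representation (range e) x (e n) \<noteq> 0}"

definition block_less :: "(nat \<Rightarrow> 'a::real_vector) \<Rightarrow> 'a \<Rightarrow> 'a \<Rightarrow> bool" where
  "block_less e x y \<longleftrightarrow> x \<noteq> 0 \<and> y \<noteq> 0 \<and> Max (vsupp e x) < Min (vsupp e y)"

definition block_seq :: "(nat \<Rightarrow> 'a::real_vector) \<Rightarrow> (nat \<Rightarrow> 'a) \<Rightarrow> bool" where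
  "block_seq e x \<longleftrightarrow> (\<forall>n. x n \<noteq> 0) \<and> (\<forall>n. block_less e (x n) (x (Suc n)))"

definition block_subseq ::
    "(nat \<Rightarrow> 'a::real_vector) \<Rightarrow> (nat \<Rightarrow> 'a) \<Rightarrow> (nat \<Rightarrow> 'a) \<Rightarrow> bool" where
  "block_subseq e Y Z \<longleftrightarrow> block_seq e Y \<and> block_seq e Z \<and> (\<forall>n. Y n \<in> span (range Z))"

definition block_seqs :: "(nat \<Rightarrow> 'a::real_vector) \<Rightarrow> 'a set \<Rightarrow> (nat \<Rightarrow> 'a) set" where
  "block_seqs e D = {x. block_seq e x \<and> (\<forall>n. x n \<in> D)}"

definition block_seqs_below ::
    "(nat \<Rightarrow> 'a::real_vector) \<Rightarrow> 'a set \<Rightarrow> (nat \<Rightarrow> 'a) \<Rightarrow> (nat \<Rightarrow> 'a) set" where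
  "block_seqs_below e D Z = {Y \<in> block_seqs e D. block_subseq e Y Z}"

text \<open>
  The game \<open>G\<^sub>D(Z)\<close>. A strategy \<open>\<sigma>\<close> of player II maps the nonempty list \<open>[W\<^sub>0, \<dots>, W\<^sub>n]\<close> of
  the moves made so far by player I to the answer \<open>w\<^sub>n\<close>; the earlier answers of player II
  are determined by \<open>\<sigma>\<close> and need not be passed as arguments.
\<close>

definition gowers_II_strategy ::
    "(nat \<Rightarrow> 'a::real_vector) \<Rightarrow> 'a set \<Rightarrow> (nat \<Rightarrow> 'a) \<Rightarrow> ((nat \<Rightarrow> 'a) list \<Rightarrow> 'a) \<Rightarrow> bool" where
  "gowers_II_strategy e D Z \<sigma> \<longleftrightarrow>
     (\<forall>Ws. Ws \<noteq> [] \<and> set Ws \<subseteq> block_seqs_below e D Z \<longrightarrow>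
        \<sigma> Ws \<in> span (range (last Ws)) \<inter> D)"

definition gowers_II_outcome ::
    "((nat \<Rightarrow> 'a) list \<Rightarrow> 'a) \<Rightarrow> (nat \<Rightarrow> nat \<Rightarrow> 'a) \<Rightarrow> nat \<Rightarrow> 'a" where
  "gowers_II_outcome \<sigma> W = (\<lambda>n. \<sigma> (map W [0..<Suc n]))"

definition gowers_II_wins ::
    "(nat \<Rightarrow> 'a::real_vector) \<Rightarrow> 'a set \<Rightarrow> (nat \<Rightarrow> 'a) \<Rightarrow> (nat \<Rightarrow> 'a) set \<Rightarrow> bool" where
  "gowers_II_wins e D Z G \<longleftrightarrow>
     (\<exists>\<sigma>. gowers_II_strategy e D Z \<sigma> \<and>
        (\<forall>W. (\<forall>n. W n \<in> block_seqs_below e D Z) \<longrightarrow> gowers_II_outcome \<sigma> W \<in> G))"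

end

theory Submission
  imports Defs "HOL-Library.Omega_Words_Fun"
begin

text \<open>
  Let \<open>G\<close> be the image of the Baire space under \<open>f\<close> and let \<open>A s\<close> be the image of the basic
  open set given by \<open>s\<close>. By a diagonalization, there is \<open>Y\<close> below \<open>U\<close> such that for every finite
  sequence \<open>x\<close> of vectors and every \<open>s\<close>, either all sufficiently late \<open>z\<close> below \<open>Y\<close> satisfy
  \<open>x \<frown> z \<notin> A s\<close>, or no \<open>Z\<close> below \<open>Y\<close> has this property. Let \<open>P\<close> be the set of pairs \<open>(x, s)\<close>
  of the second kind. If \<open>([], [])\<close> is not in \<open>P\<close>, then a tail of \<open>Y\<close> avoids \<open>G\<close>.
  Otherwise consider, for \<open>(x, s) \<in> P\<close>, the open game in which player II, starting from \<open>x\<close>,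
  tries to reach some \<open>x'\<close> with \<open>(x', s @ [k]) \<in> P\<close> for some \<open>k\<close>. By the dichotomy for open
  games either she can do so below some \<open>Z\<close>, or some \<open>Z\<close> avoids all such \<open>x'\<close>. The latter is
  impossible: as only finitely many vectors of \<open>D\<close> live on an initial segment of the basis, \<open>Z\<close> can be
  thinned out so that its vectors exceed all relevant thresholds, and then \<open>x \<frown> z \<in> A s\<close> fails
  for all \<open>z\<close> below \<open>Z\<close>, as it fails for each \<open>A (s @ [k])\<close>. After another diagonalization player II can pass
  from \<open>P\<close> to \<open>P\<close> forever; this produces a sequence \<open>\<alpha>\<close> of digits, and by continuity the
  outcome is \<open>f \<alpha> \<in> G\<close>.
\<close>

section \<open>Supports and block sequences\<close>

locale hamel_basis =
  fixes e :: "nat \<Rightarrow> 'a::real_vector"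
  assumes inj_e: "inj e" and independent_e: "independent (range e)"
    and span_e: "span (range e) = UNIV"
begin

abbreviation coord :: "'a \<Rightarrow> nat \<Rightarrow> real" where
  "coord v n \<equiv> representation (range e) v (e n)"

lemma coord_zero: "coord 0 n = 0"
  by (simp add: representation_zero)

lemma coord_add: "coord (v + w) n = coord v n + coord w n"
  using representation_add[OF independent_e] span_e by simp

lemma coord_scale: "coord (c *\<^sub>R v) n = c * coord v n"
  using representation_scale[OF independent_e] span_e by simp

lemma coord_basis: "coord (e m) n = (if m = n then 1 else 0)"
  using representation_basis[OF independent_e, of "e m"] inj_e by (auto simp: inj_eq)

lemma in_vsupp: "n \<in> vsupp e v \<longleftrightarrow> coord v n \<noteq> 0"
  by (simp add: vsupp_def)

lemma finite_vsupp: "finite (vsupp e v)"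
proof -
  have "e ` vsupp e v \<subseteq> {b. representation (range e) v b \<noteq> 0}"
    by (auto simp: vsupp_def)
  then have "finite (e ` vsupp e v)"
    using finite_representation finite_subset by blast
  then show ?thesis
    using inj_e by (meson finite_imageD inj_on_subset subset_UNIV)
qed

lemma vsupp_subset_iff: "vsupp e v \<subseteq> A \<longleftrightarrow> v \<in> span (e ` A)"
proof
  assume A: "vsupp e v \<subseteq> A"
  have "(\<Sum>b | representation (range e) v b \<noteq> 0. representation (range e) v b *\<^sub>R b) = v"
    using sum_nonzero_representation_eq[OF independent_e] span_e by simp
  moreover have "b \<in> e ` A" if "representation (range e) v b \<noteq> 0" for b
    using that A representation_ne_zero[OF that] by (auto simp: in_vsupp[symmetric])
  then have "(\<Sum>b | representation (range e) v b \<noteq> 0. representation (range e) v b *\<^sub>R b) \<in> span (e ` A)"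
    by (intro span_sum span_scale span_base) auto
  ultimately show "v \<in> span (e ` A)" by simp
next
  assume "v \<in> span (e ` A)"
  then show "vsupp e v \<subseteq> A"
  proof (induction rule: span_induct_alt)
    case base
    then show ?case by (simp add: vsupp_def coord_zero)
  next
    case (step c x y)
    then show ?case
      by (auto simp: in_vsupp coord_add coord_scale coord_basis subset_iff split: if_splits)
  qed
qed

lemma vsupp_empty_iff: "vsupp e v = {} \<longleftrightarrow> v = 0"
  using vsupp_subset_iff[of v "{}"] by simp

lemma vsupp_span_subset:
  assumes "v \<in> span S"
  shows "vsupp e v \<subseteq> (\<Union>x\<in>S. vsupp e x)"
proof -
  have "S \<subseteq> span (e ` (\<Union>x\<in>S. vsupp e x))"
    by (auto simp: vsupp_subset_iff[symmetric])
  then have "span S \<subseteq> span (e ` (\<Union>x\<in>S. vsupp e x))"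
    by (intro span_minimal subspace_span)
  then show ?thesis
    using assms by (auto simp: vsupp_subset_iff)
qed

lemma block_less_iff:
  "block_less e x y \<longleftrightarrow> x \<noteq> 0 \<and> y \<noteq> 0 \<and> (\<forall>i\<in>vsupp e x. \<forall>j\<in>vsupp e y. i < j)"
  by (auto simp: block_less_def finite_vsupp vsupp_empty_iff)

lemma block_less_trans: "block_less e x y \<Longrightarrow> block_less e y z \<Longrightarrow> block_less e x z"
  unfolding block_less_iff by (metis ex_in_conv less_trans vsupp_empty_iff)

lemma block_seq_less:
  assumes "block_seq e x" "m < n"
  shows "block_less e (x m) (x n)"
  using assms(2)
proof (induction rule: less_Suc_induct)
  case (1 i)
  then show ?case using assms(1) by (simp add: block_seq_def)
qed (blast intro: block_less_trans)

lemma block_seqD: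
  assumes "block_seq e x" "m < n" "i \<in> vsupp e (x m)" "j \<in> vsupp e (x n)"
  shows "i < j"
  using block_seq_less[OF assms(1,2)] assms(3,4) by (auto simp: block_less_iff)

lemma block_seq_ge:
  assumes "block_seq e x" "i \<in> vsupp e (x n)"
  shows "n \<le> i"
  using assms(2)
proof (induction n arbitrary: i)
  case (Suc n)
  have "x n \<noteq> 0" using assms(1) by (simp add: block_seq_def)
  then obtain j where "j \<in> vsupp e (x n)" using vsupp_empty_iff by blast
  then show ?case
    using Suc block_seqD[OF assms(1), of n "Suc n" j i] by fastforce
qed simp

text \<open>On the support of \<open>Z j\<close> every other \<open>Z k\<close> has coordinate zero,
  so a combination of the \<open>Z k\<close> restricts there to a multiple of \<open>Z j\<close>. A
  single nonzero coordinate forces the factor to be nonzero.\<close>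

lemma block_seq_span_saturated:
  assumes Z: "block_seq e Z" and v: "v \<in> span (range Z)"
    and i: "i \<in> vsupp e (Z j)" "i \<in> vsupp e v"
  shows "vsupp e (Z j) \<subseteq> vsupp e v"
proof -
  have "\<exists>c. \<forall>n\<in>vsupp e (Z j). coord v n = c * coord (Z j) n"
    using v
  proof (induction rule: span_induct_alt)
    case base
    show ?case by (rule exI[of _ 0]) (simp add: coord_zero)
  next
    case (step c x y)
    then obtain d k where d: "\<forall>n\<in>vsupp e (Z j). coord y n = d * coord (Z j) n" and k: "x = Z k"
      by auto
    show ?case
    proof (cases "k = j")
      case True
      then show ?thesis
        using d k by (intro exI[of _ "c + d"]) (auto simp: coord_add coord_scale algebra_simps)
    next
      case False
      then have "coord x n = 0" if "n \<in> vsupp e (Z j)" for n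
        using that block_seqD[OF Z, of k j n n] block_seqD[OF Z, of j k n n] k in_vsupp
        by (meson linorder_neqE_nat less_irrefl)
      then show ?thesis
        using d by (intro exI[of _ d]) (auto simp: coord_add coord_scale)
    qed
  qed
  then show ?thesis using i by (auto simp: in_vsupp)
qed

text \<open>Take \<open>n\<close> past the supports of the first \<open>k\<close> vectors. The part
  of \<open>v\<close> spanned by them cannot be cancelled by the tail, whose support is disjoint
  from theirs, so it vanishes once \<open>v\<close> has no coordinate below
  \<open>n\<close>.\<close>

lemma span_block_tail:
  assumes Z: "block_seq e Z"
  shows "\<exists>n. \<forall>v\<in>span (range Z). vsupp e v \<subseteq> {n..} \<longrightarrow> v \<in> span (Z ` {k..})"
proof -
  define F where "F = (\<Union>i<k. vsupp e (Z i))"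
  have "finite F" by (simp add: F_def finite_vsupp)
  then obtain n where n: "F \<subseteq> {..<n}"
    using finite_nat_bounded by blast
  have "v \<in> span (Z ` {k..})" if v: "v \<in> span (range Z)" "vsupp e v \<subseteq> {n..}" for v
  proof -
    have "{..<k} \<union> {k..} = UNIV" by auto
    then have "range Z = Z ` {..<k} \<union> Z ` {k..}" by (metis image_Un)
    then obtain a b where ab: "a \<in> span (Z ` {..<k})" "b \<in> span (Z ` {k..})" "v = a + b"
      using v(1) by (auto simp: span_Un)
    have a: "vsupp e a \<subseteq> F"
      using vsupp_span_subset[OF ab(1)] by (auto simp: F_def)
    have b: "vsupp e b \<subseteq> (\<Union>i\<in>{k..}. vsupp e (Z i))"
      using vsupp_span_subset[OF ab(2)] by auto
    have "F \<inter> vsupp e b = {}"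
    proof (rule ccontr)
      assume "F \<inter> vsupp e b \<noteq> {}"
      then obtain t i j where "t \<in> vsupp e (Z i)" "i < k" "t \<in> vsupp e (Z j)" "k \<le> j"
        using b unfolding F_def by blast
      then show False using block_seqD[OF Z, of i j t t] by simp
    qed
    then have "vsupp e a \<subseteq> vsupp e v"
      using a by (auto simp: in_vsupp coord_add ab(3))
    then have "vsupp e a = {}" using a n v(2) by fastforce
    then show ?thesis using ab vsupp_empty_iff by simp
  qed
  then show ?thesis by blast
qed

end

section \<open>Block sequences from \<open>D\<close> and almost inclusion of their spans\<close>

locale gowers_space = hamel_basis e for e :: "nat \<Rightarrow> 'a::real_vector" +
  fixes D :: "'a set"
  assumes finite_D: "\<And>n. finite (D \<inter> span (e ` {..<n}))"
begin

abbreviation below :: "(nat \<Rightarrow> 'a) \<Rightarrow> (nat \<Rightarrow> 'a) set" where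
  "below Z \<equiv> block_seqs_below e D Z"

text \<open>The analogue of inclusion modulo finite sets: only vectors that start late are compared.
  A diagonal sequence has this relation to all sequences it is built from, while it may fail to be
  below them.\<close>

definition almost_sub :: "(nat \<Rightarrow> 'a) \<Rightarrow> (nat \<Rightarrow> 'a) \<Rightarrow> bool" (infix \<open>\<sqsubseteq>\<close> 50) where
  "Y \<sqsubseteq> Z \<longleftrightarrow> (\<exists>n. \<forall>v\<in>span (range Y). vsupp e v \<subseteq> {n..} \<longrightarrow> v \<in> span (range Z))"

lemma countable_D: "countable D"
proof -
  have "v \<in> (\<Union>n. D \<inter> span (e ` {..<n}))" if "v \<in> D" for v
  proof -
    obtain n where "vsupp e v \<subseteq> {..<n}"
      using finite_nat_bounded[OF finite_vsupp] by blast
    then show ?thesis using that vsupp_subset_iff by blast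
  qed
  then have "D = (\<Union>n. D \<inter> span (e ` {..<n}))" by blast
  also have "countable \<dots>"
    using finite_D by (intro countable_UN) (auto intro: countable_finite)
  finally show ?thesis .
qed

lemma below_iff:
  "Y \<in> below Z \<longleftrightarrow> Y \<in> block_seqs e D \<and> block_seq e Z \<and> (\<forall>n. Y n \<in> span (range Z))"
  by (auto simp: block_seqs_below_def block_subseq_def block_seqs_def)

lemma block_seqs_iff: "Y \<in> block_seqs e D \<longleftrightarrow> block_seq e Y \<and> range Y \<subseteq> D"
  by (auto simp: block_seqs_def)

lemma below_span: "Y \<in> below Z \<Longrightarrow> span (range Y) \<subseteq> span (range Z)"
  by (intro span_minimal subspace_span) (auto simp: below_iff)

lemma below_refl: "Y \<in> block_seqs e D \<Longrightarrow> Y \<in> below Y"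
  by (auto simp: below_iff block_seqs_iff span_base)

lemma below_trans: "X \<in> below Y \<Longrightarrow> Y \<in> below Z \<Longrightarrow> X \<in> below Z"
  using below_span[of Y Z] by (auto simp: below_iff)

lemma below_imp_almost_sub: "Y \<in> below Z \<Longrightarrow> Y \<sqsubseteq> Z"
  unfolding almost_sub_def using below_span by blast

lemma almost_sub_trans:
  assumes "X \<sqsubseteq> Y" "Y \<sqsubseteq> Z"
  shows "X \<sqsubseteq> Z"
proof -
  obtain m n where "\<forall>v\<in>span (range X). vsupp e v \<subseteq> {m..} \<longrightarrow> v \<in> span (range Y)"
    "\<forall>v\<in>span (range Y). vsupp e v \<subseteq> {n..} \<longrightarrow> v \<in> span (range Z)"
    using assms by (auto simp: almost_sub_def)
  then have "\<forall>v\<in>span (range X). vsupp e v \<subseteq> {max m n..} \<longrightarrow> v \<in> span (range Z)"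
    by (meson atLeast_subset_iff max.cobounded1 max.cobounded2 order_trans)
  then show ?thesis unfolding almost_sub_def by blast
qed

lemma block_seqs_subseq:
  assumes "Y \<in> block_seqs e D" "strict_mono r"
  shows "(\<lambda>n. Y (r n)) \<in> below Y"
  using assms block_seq_less[of Y]
  by (auto simp: below_iff block_seqs_def block_seq_def span_base strict_mono_def)

lemma suffix_below: "Y \<in> block_seqs e D \<Longrightarrow> suffix k Y \<in> below Y"
  using block_seqs_subseq[of Y "\<lambda>n. k + n"] by (simp add: suffix_def strict_mono_def)

text \<open>The \<open>n\<close>-th vector of a block sequence has support in \<open>{n..}\<close>,
  so dropping as many vectors as the threshold says turns almost inclusion into genuine
  inclusion.\<close>

lemma almost_sub_below_suffix:
  assumes Z: "Z \<in> block_seqs e D" and Y: "Y \<in> block_seqs e D" and le: "Z \<sqsubseteq> Y"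
  shows "\<exists>k. suffix k Z \<in> below Y"
proof -
  obtain k where k: "\<forall>v\<in>span (range Z). vsupp e v \<subseteq> {k..} \<longrightarrow> v \<in> span (range Y)"
    using le by (auto simp: almost_sub_def)
  have "suffix k Z n \<in> span (range Y)" for n
  proof -
    have "vsupp e (Z (k + n)) \<subseteq> {k..}"
      using block_seq_ge[of Z _ "k + n"] Z by (fastforce simp: block_seqs_iff)
    then show ?thesis using k by (simp add: span_base)
  qed
  then show ?thesis
    using suffix_below[OF Z, of k] Y by (auto simp: below_iff block_seqs_iff)
qed

lemma below_block_seqs: "Y \<in> below Z \<Longrightarrow> Y \<in> block_seqs e D"
  by (simp add: below_iff)

section \<open>Diagonalization and open games\<close>

text \<open>Fusion: a descending sequence \<open>Y n\<close> handles the members of \<open>I\<close>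
  one by one. A diagonal sequence through the \<open>Y n\<close> is almost below all of them and so
  inherits every property secured on the way.\<close>

lemma diagonalize:
  assumes I: "countable I" and U: "U \<in> block_seqs e D"
    and dense: "\<And>p Y. p \<in> I \<Longrightarrow> Y \<in> below U \<Longrightarrow> \<exists>Z\<in>below Y. Q p Z"
    and hereditary: "\<And>p Y Z. p \<in> I \<Longrightarrow> Q p Y \<Longrightarrow> Y \<in> block_seqs e D \<Longrightarrow> Z \<in> block_seqs e D
      \<Longrightarrow> Z \<sqsubseteq> Y \<Longrightarrow> Q p Z"
  shows "\<exists>Z\<in>below U. \<forall>p\<in>I. Q p Z"
proof (cases "I = {}")
  case True
  then show ?thesis using below_refl[OF U] by blast
next
  case False
  then obtain p :: "nat \<Rightarrow> 'b" where p: "range p = I"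
    using I uncountable_def by blast
  have "\<exists>Y. \<forall>n. Y n \<in> below U \<and> (Y (Suc n) \<in> below (Y n) \<and> Q (p n) (Y (Suc n)))"
    by (rule dependent_nat_choice) (use below_refl[OF U] dense p below_trans in blast)+
  then obtain Y where YU: "\<And>n. Y n \<in> below U" and YS: "\<And>n. Y (Suc n) \<in> below (Y n)"
    and QY: "\<And>n. Q (p n) (Y (Suc n))" by blast
  have YB: "Y n \<in> block_seqs e D" for n using YU below_block_seqs by blast
  have mono: "Y n \<in> below (Y m)" if "m \<le> n" for m n
    using that
  proof (induction rule: dec_induct)
    case base
    show ?case by (rule below_refl[OF YB])
  qed (use YS below_trans in blast)
  \<comment> \<open>The index \<open>r (Suc n)\<close> exceeds the support of \<open>Z n\<close>; as
    the vector of \<open>Y (Suc n)\<close> with that index starts no earlier, \<open>Z\<close> is a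
    block sequence.\<close>
  define r where "r = rec_nat 0 (\<lambda>n k. Suc (Max (vsupp e (Y n k))))"
  have rS: "r (Suc n) = Suc (Max (vsupp e (Y n (r n))))" for n by (simp add: r_def)
  define Z where "Z n = Y n (r n)" for n
  have Zn: "Z n \<in> range (Y n)" for n by (simp add: Z_def)
  have less: "block_less e (Z n) (Z (Suc n))" for n
  proof -
    have "i < j" if "i \<in> vsupp e (Z n)" "j \<in> vsupp e (Z (Suc n))" for i j
    proof -
      have "i < r (Suc n)"
        using that(1) by (simp add: rS Z_def less_Suc_eq_le finite_vsupp)
      also have "r (Suc n) \<le> j"
        using that(2) block_seq_ge[of "Y (Suc n)"] YB by (auto simp: Z_def block_seqs_iff)
      finally show ?thesis .
    qed
    then show ?thesis
      using YB by (auto simp: block_less_iff Z_def block_seqs_def block_seq_def)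
  qed
  then have Z: "Z \<in> block_seqs e D"
    using YB by (auto simp: block_seqs_def block_seq_def block_less_def Z_def)
  have Zspan: "Z n \<in> span (range (Y m))" if "m \<le> n" for m n
    using mono[OF that] by (simp add: below_iff Z_def)
  \<comment> \<open>From index \<open>m\<close> on, \<open>Z\<close> lies in the span of
    \<open>Y m\<close>, and late vectors in the span of \<open>Z\<close> involve only this
    tail.\<close>
  have "Z \<sqsubseteq> Y m" for m
  proof -
    have "span (Z ` {m..}) \<subseteq> span (range (Y m))"
      using Zspan by (intro span_minimal subspace_span) auto
    then show ?thesis
      using span_block_tail[of Z m] Z unfolding almost_sub_def block_seqs_iff by blast
  qed
  then have "\<forall>q\<in>I. Q q Z"
    using hereditary[OF _ QY YB Z] p by blast
  moreover have "Z n \<in> span (range U)" for n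
    using Zspan[of 0 n] below_span[OF YU[of 0]] by blast
  then have "Z \<in> below U"
    using Z U by (simp add: below_iff block_seqs_iff)
  ultimately show ?thesis by blast
qed

text \<open>The property "\<open>R p\<close> holds, or it fails at everything almost below" is
  hereditary. It is also dense: if some \<open>X\<close> almost below \<open>Y\<close> satisfies
  \<open>R p\<close>, a suffix of \<open>X\<close> lies below \<open>Y\<close> and still
  does.\<close>

lemma decide:
  assumes I: "countable I" and U: "U \<in> block_seqs e D"
    and hereditary: "\<And>p Y Z. p \<in> I \<Longrightarrow> R p Y \<Longrightarrow> Y \<in> block_seqs e D \<Longrightarrow> Z \<in> block_seqs e D
      \<Longrightarrow> Z \<sqsubseteq> Y \<Longrightarrow> R p Z"
  shows "\<exists>Z\<in>below U. \<forall>p\<in>I. R p Z \<or> (\<forall>Y\<in>block_seqs e D. Y \<sqsubseteq> Z \<longrightarrow> \<not> R p Y)"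
proof (rule diagonalize[OF I U])
  fix p Y assume p: "p \<in> I" and Y: "Y \<in> below U"
  show "\<exists>Z\<in>below Y. R p Z \<or> (\<forall>Y\<in>block_seqs e D. Y \<sqsubseteq> Z \<longrightarrow> \<not> R p Y)"
  proof (cases "\<exists>X\<in>block_seqs e D. X \<sqsubseteq> Y \<and> R p X")
    case True
    then obtain X where X: "X \<in> block_seqs e D" "X \<sqsubseteq> Y" "R p X" by blast
    obtain k where k: "suffix k X \<in> below Y"
      using almost_sub_below_suffix[OF X(1) below_block_seqs[OF Y] X(2)] by blast
    then have "R p (suffix k X)"
      using hereditary[OF p X(3,1)] suffix_below[OF X(1)] below_block_seqs below_imp_almost_sub
      by blast
    then show ?thesis using k by blast
  next
    case False
    then show ?thesis using below_refl[OF below_block_seqs[OF Y]] by blast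
  qed
next
  fix p Y Z
  assume p: "p \<in> I" and R: "R p Y \<or> (\<forall>X\<in>block_seqs e D. X \<sqsubseteq> Y \<longrightarrow> \<not> R p X)"
    and YZ: "Y \<in> block_seqs e D" "Z \<in> block_seqs e D" "Z \<sqsubseteq> Y"
  show "R p Z \<or> (\<forall>X\<in>block_seqs e D. X \<sqsubseteq> Z \<longrightarrow> \<not> R p X)"
    using R hereditary[OF p _ YZ] almost_sub_trans YZ(3) by blast
qed

text \<open>Here finiteness of the sets \<open>D \<inter> span (e ` {..<n})\<close> is essential: only finitely many
  sequences have to be taken into account when the next vector of \<open>Z\<close> is chosen.\<close>

lemma sparse_subsequence:
  assumes Y: "Y \<in> block_seqs e D"
  shows "\<exists>Z\<in>below Y. \<forall>z\<in>below Z. \<forall>m. vsupp e (z m) \<subseteq> {h (prefix m z)..}"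
proof -
  \<comment> \<open>\<open>L N\<close> is a finite set containing every list that can precede a
    vector meeting a block \<open>Z j\<close> with \<open>N = N j\<close>, and \<open>g\<close>
    bounds \<open>h\<close> on it.\<close>
  define L where "L N = {l. set l \<subseteq> D \<inter> span (e ` {..<N}) \<and> length l \<le> N}" for N :: nat
  define g where "g N = Max (insert N (h ` L N))" for N
  have "finite (L N)" for N
    unfolding L_def by (rule finite_lists_length_le[OF finite_D])
  then have gN: "N \<le> g N" and gL: "\<And>l. l \<in> L N \<Longrightarrow> h l \<le> g N" for N
    by (auto simp: g_def)
  \<comment> \<open>\<open>N (Suc n)\<close> is the first index after the support of
    \<open>Z n\<close>, and \<open>N 0 = 0\<close>.\<close>
  define N where "N = rec_nat 0 (\<lambda>_ k. Suc (Max (vsupp e (Y (g k)))))"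
  define Z where "Z n = Y (g (N n))" for n
  have NS: "N (Suc n) = Suc (Max (vsupp e (Z n)))" for n by (simp add: N_def Z_def)
  have Yne: "vsupp e (Y n) \<noteq> {}" for n
    using Y by (simp add: block_seqs_def block_seq_def vsupp_empty_iff)
  have Yge: "n \<le> i" if "i \<in> vsupp e (Y n)" for n i
    using that block_seq_ge Y by (auto simp: block_seqs_iff)
  have Zlt: "i < N (Suc n)" if "i \<in> vsupp e (Z n)" for i n
    using that by (simp add: NS less_Suc_eq_le finite_vsupp)
  have Zge: "g (N n) \<le> i" if "i \<in> vsupp e (Z n)" for i n
    using that Yge by (simp add: Z_def)
  have gNS: "g (N n) < N (Suc n)" for n
    using Yne[of "g (N n)"] Zge[of _ n] Zlt[of _ n] by (force simp: Z_def)
  then have "strict_mono (\<lambda>n. g (N n))"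
    using gN by (auto simp: strict_mono_Suc_iff intro: less_le_trans)
  then have ZY: "Z \<in> below Y"
    using block_seqs_subseq[OF Y] by (simp add: Z_def[abs_def])
  then have Z: "block_seq e Z" by (simp add: below_iff block_seqs_iff)
  have "strict_mono N"
    using gNS gN by (auto simp: strict_mono_Suc_iff intro: le_less_trans)
  then have Nmono: "N i \<le> N j" if "i \<le> j" for i j
    using that by (simp add: strict_mono_less_eq)
  have "h (prefix m z) \<le> q" if z: "z \<in> below Z" and q: "q \<in> vsupp e (z m)" for z m q
  proof -
    have zs: "z i \<in> span (range Z)" and zD: "z i \<in> D" for i
      using z by (auto simp: below_iff block_seqs_def)
    have zb: "block_seq e z" using z by (simp add: below_iff block_seqs_iff)
    obtain j where j: "q \<in> vsupp e (Z j)"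
      using vsupp_span_subset[OF zs[of m]] q by blast
    \<comment> \<open>By saturation \<open>z m\<close> contains the whole block \<open>Z j\<close>,
      so the earlier vectors of \<open>z\<close> end before that block begins and involve only
      blocks of smaller index.\<close>
    have sat: "vsupp e (Z j) \<subseteq> vsupp e (z m)"
      by (rule block_seq_span_saturated[OF Z zs j q])
    have lt: "t < N j" if im: "i < m" and t: "t \<in> vsupp e (z i)" for i t
    proof -
      obtain k where k: "t \<in> vsupp e (Z k)"
        using vsupp_span_subset[OF zs[of i]] t by blast
      have "t < s" if "s \<in> vsupp e (Z j)" for s
        using that sat block_seqD[OF zb im t] by blast
      then have "k < j"
        using k j block_seqD[OF Z, of j k] by (metis less_asym less_irrefl linorder_neqE_nat)
      then show ?thesis
        using Zlt[OF k] Nmono[of "Suc k" j] by simp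
    qed
    \<comment> \<open>The vector just before \<open>z m\<close> has an index at least
      \<open>m - 1\<close> in its support, and this index is below \<open>N j\<close>.\<close>
    have "m \<le> N j"
    proof (cases m)
      case (Suc i)
      obtain t where "t \<in> vsupp e (z i)"
        using zb vsupp_empty_iff by (fastforce simp: block_seq_def)
      then show ?thesis
        using Suc lt[of i t] block_seq_ge[OF zb, of t i] by simp
    qed simp
    moreover have "z i \<in> span (e ` {..<N j})" if "i < m" for i
      using lt[OF that] vsupp_subset_iff by blast
    ultimately have "prefix m z \<in> L (N j)"
      using zD by (auto simp: L_def subsequence_def)
    then show ?thesis using gL Zge[OF j] by fastforce
  qed
  then show ?thesis using ZY by blast
qed

text \<open>Player II wins the open game with target \<open>T\<close> from the position \<open>x\<close>. The inductive
  definition avoids strategies and ordinal ranks.\<close>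

inductive forced :: "(nat \<Rightarrow> 'a) \<Rightarrow> 'a list set \<Rightarrow> 'a list \<Rightarrow> bool" for Z T where
  reached: "x \<in> T \<Longrightarrow> forced Z T x"
| move: "(\<And>W. W \<in> below Z \<Longrightarrow> \<exists>y\<in>span (range W) \<inter> D. forced Z T (x @ [y])) \<Longrightarrow> forced Z T x"

text \<open>A move \<open>W\<close> below \<open>Y\<close> has a suffix that is a legal move below
  \<open>Z\<close>. An answer to the suffix also answers \<open>W\<close>.\<close>

lemma forced_almost_sub:
  assumes "forced Z T x" and Y: "Y \<in> block_seqs e D" "Z \<in> block_seqs e D" "Y \<sqsubseteq> Z"
  shows "forced Y T x"
  using assms(1)
proof induction
  case (reached x)
  then show ?case by (rule forced.reached)
next
  case (move x)
  show ?case
  proof (rule forced.move)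
    fix W assume W: "W \<in> below Y"
    then have WB: "W \<in> block_seqs e D" by (rule below_block_seqs)
    obtain k where k: "suffix k W \<in> below Z"
      using almost_sub_below_suffix[OF WB Y(2)] below_imp_almost_sub[OF W] Y(3) almost_sub_trans
      by blast
    then show "\<exists>y\<in>span (range W) \<inter> D. forced Y T (x @ [y])"
      using move[OF k] below_span[OF suffix_below[OF WB, of k]] by blast
  qed
qed

text \<open>First \<open>V\<close> decides all positions at once. Then \<open>X\<close> is chosen so
  that every late vector leads from an unforced position to an unforced one, and
  \<open>sparse_subsequence\<close> makes all vectors late enough. By induction no position along
  such a sequence is forced, and in particular none is in \<open>T\<close>.\<close>

lemma forced_or_avoids:
  assumes Y: "Y \<in> block_seqs e D" and x: "x \<in> lists D"
  shows "\<exists>Z\<in>below Y. forced Z T x \<or> (\<forall>z\<in>below Z. \<forall>m. x @ prefix m z \<notin> T)"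
proof -
  have cD: "countable (lists D)" using countable_D by (rule countable_lists)
  obtain V where VY: "V \<in> below Y"
    and V: "\<And>p. p \<in> lists D \<Longrightarrow> forced V T p \<or> (\<forall>X\<in>block_seqs e D. X \<sqsubseteq> V \<longrightarrow> \<not> forced X T p)"
    using decide[OF cD Y, of "\<lambda>p Z. forced Z T p"] forced_almost_sub by blast
  have VB: "V \<in> block_seqs e D" using VY by (rule below_block_seqs)
  let ?Q = "\<lambda>p X. forced V T p \<or>
    (\<exists>n. \<forall>y\<in>span (range X) \<inter> D. vsupp e y \<subseteq> {n..} \<longrightarrow> \<not> forced V T (p @ [y]))"
  have "\<exists>Z\<in>below V. \<forall>p\<in>lists D. ?Q p Z"
  proof (rule diagonalize[OF cD VB])
    fix p X assume p: "p \<in> lists D" and X: "X \<in> below V"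
    show "\<exists>Z\<in>below X. ?Q p Z"
    proof (cases "forced V T p")
      case True
      then show ?thesis using below_refl[OF below_block_seqs[OF X]] by blast
    next
      case False
      \<comment> \<open>Since \<open>V\<close> has decided \<open>p\<close>, the position is
        unforced for \<open>X\<close> too, so player I has a move \<open>W\<close> all of whose
        answers are unforced for \<open>X\<close>. Positions forced for \<open>V\<close> are forced
        for \<open>X\<close>, hence these answers are unforced for \<open>V\<close>.\<close>
      then have "\<not> forced X T p"
        using V[OF p] X below_block_seqs below_imp_almost_sub by blast
      then obtain W where W: "W \<in> below X" "\<And>y. y \<in> span (range W) \<inter> D \<Longrightarrow> \<not> forced X T (p @ [y])"
        using forced.move by blast
      have "\<not> forced V T (p @ [y])" if "y \<in> span (range W) \<inter> D" for y
        using W(2)[OF that] forced_almost_sub[OF _ below_block_seqs[OF X] VB below_imp_almost_sub[OF X]]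
        by blast
      then show ?thesis using W(1) by blast
    qed
  next
    fix p X Z
    assume "?Q p X" and "Z \<sqsubseteq> X"
    then show "?Q p Z"
    proof (elim disjE exE)
      fix n assume n: "\<forall>y\<in>span (range X) \<inter> D. vsupp e y \<subseteq> {n..} \<longrightarrow> \<not> forced V T (p @ [y])"
      obtain k where k: "\<forall>v\<in>span (range Z). vsupp e v \<subseteq> {k..} \<longrightarrow> v \<in> span (range X)"
        using \<open>Z \<sqsubseteq> X\<close> by (auto simp: almost_sub_def)
      have "\<forall>y\<in>span (range Z) \<inter> D. vsupp e y \<subseteq> {max k n..} \<longrightarrow> \<not> forced V T (p @ [y])"
        using n k by (simp add: subset_iff)
      then show ?thesis by blast
    qed blast
  qed
  then obtain X where XV: "X \<in> below V" and "\<forall>p\<in>lists D. ?Q p X" by blast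
  then obtain h where h: "\<And>p y. p \<in> lists D \<Longrightarrow> \<not> forced V T p \<Longrightarrow> y \<in> span (range X) \<inter> D
      \<Longrightarrow> vsupp e y \<subseteq> {h p..} \<Longrightarrow> \<not> forced V T (p @ [y])"
    by metis
  obtain Z where ZX: "Z \<in> below X"
    and Z: "\<And>z m. z \<in> below Z \<Longrightarrow> vsupp e (z m) \<subseteq> {h (x @ prefix m z)..}"
    using sparse_subsequence[OF below_block_seqs[OF XV], of "\<lambda>l. h (x @ l)"] by blast
  have ZV: "Z \<in> below V" using ZX XV by (rule below_trans)
  have "forced Z T x" if "forced V T x"
    using forced_almost_sub[OF that below_block_seqs[OF ZV] VB below_imp_almost_sub[OF ZV]] .
  moreover have "x @ prefix m z \<notin> T" if nf: "\<not> forced V T x" and z: "z \<in> below Z" for z m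
  proof -
    have zX: "z i \<in> span (range X) \<inter> D" for i
      using below_trans[OF z ZX] by (auto simp: below_iff block_seqs_def)
    have "\<not> forced V T (x @ prefix m z)"
    proof (induction m)
      case 0
      then show ?case using nf by (simp add: subsequence_def)
    next
      case (Suc m)
      have "x @ prefix m z \<in> lists D" using x zX by (auto simp: subsequence_def)
      then show ?case
        using h[OF _ Suc zX Z[OF z]] by (simp add: subsequence_def)
    qed
    then show ?thesis using forced.reached by blast
  qed
  ultimately show ?thesis using ZV VY below_trans by blast
qed

end

section \<open>Outcomes of strategies and continuity on the Baire space\<close>

lemma prefix_Suc_outcome:
  "prefix (Suc m) (gowers_II_outcome \<sigma> W) =
     \<sigma> [W 0] # prefix m (gowers_II_outcome (\<lambda>Ws. \<sigma> (W 0 # Ws)) (suffix 1 W))"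
  by (simp add: subsequence_def gowers_II_outcome_def map_upt_Suc suffix_def del: upt_Suc)

text \<open>The \<open>i\<close>-th coordinate of \<open>f\<close> takes values in a discrete space,
  so its fibres are open, and a basic open set restricts only finitely many digits.\<close>

lemma continuous_baire_seq:
  assumes "continuous_map baire_space (seq_topology D) f"
  shows "\<exists>j. \<forall>\<beta>. prefix j \<beta> = prefix j \<alpha> \<longrightarrow> f \<beta> i = f \<alpha> i"
proof -
  have top: "topspace baire_space = UNIV"
    by (simp add: baire_space_def)
  have cont: "continuous_map baire_space (discrete_topology D) (\<lambda>\<beta>. f \<beta> i)"
    using assms unfolding seq_topology_def by (simp add: continuous_map_componentwise_UNIV)
  then have "f \<alpha> i \<in> D"
    using top by (auto simp: continuous_map_def)
  then have "openin baire_space {\<beta>. f \<beta> i \<in> {f \<alpha> i}}"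
    using openin_continuous_map_preimage[OF cont, of "{f \<alpha> i}"] top by simp
  then have "\<forall>x\<in>{\<beta>. f \<beta> i \<in> {f \<alpha> i}}. \<exists>V :: nat \<Rightarrow> nat set. finite {l. V l \<noteq> UNIV} \<and>
      x \<in> Pi\<^sub>E UNIV V \<and> Pi\<^sub>E UNIV V \<subseteq> {\<beta>. f \<beta> i \<in> {f \<alpha> i}}"
    unfolding baire_space_def openin_product_topology_alt by simp
  then obtain V where V: "finite {l. V l \<noteq> UNIV}" "\<alpha> \<in> Pi\<^sub>E UNIV V"
      "Pi\<^sub>E UNIV V \<subseteq> {\<beta>. f \<beta> i \<in> {f \<alpha> i}}"
    by blast
  obtain j where j: "{l. V l \<noteq> UNIV} \<subseteq> {..<j}"
    using finite_nat_bounded[OF V(1)] by blast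
  have "f \<beta> i = f \<alpha> i" if "prefix j \<beta> = prefix j \<alpha>" for \<beta>
  proof -
    have "\<beta> l \<in> V l" for l
    proof (cases "l < j")
      case True
      then have "\<beta> l = \<alpha> l" using that by (simp add: subsequence_def)
      then show ?thesis using V(2) by auto
    next
      case False
      then show ?thesis using j by auto
    qed
    then show ?thesis using V(3) by auto
  qed
  then show ?thesis by blast
qed

section \<open>The dichotomy for Souslin schemes\<close>

context gowers_space
begin

lemma below_ge:
  assumes "z \<in> below (suffix n Y)" "block_seq e Y"
  shows "vsupp e (z i) \<subseteq> {n..}"
proof -
  have "vsupp e (z i) \<subseteq> (\<Union>x\<in>range (suffix n Y). vsupp e x)"
    using assms(1) by (intro vsupp_span_subset) (auto simp: below_iff)
  also have "\<dots> \<subseteq> {n..}"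
    using block_seq_ge[OF assms(2)] by fastforce
  finally show ?thesis .
qed

text \<open>The threshold makes the notion pass to sequences that are only almost below. Bounding
  \<open>z 0\<close> suffices, because the later vectors of a block sequence start further
  out.\<close>

definition misses :: "(nat list \<Rightarrow> (nat \<Rightarrow> 'a) set) \<Rightarrow> 'a list \<Rightarrow> nat list \<Rightarrow> (nat \<Rightarrow> 'a) \<Rightarrow> bool" where
  "misses A x s Y \<longleftrightarrow> (\<exists>n. \<forall>z\<in>below Y. vsupp e (z 0) \<subseteq> {n..} \<longrightarrow> x \<frown> z \<notin> A s)"

lemma misses_almost_sub:
  assumes "misses A x s Y" and Y: "Y \<in> block_seqs e D" and "Z \<sqsubseteq> Y"
  shows "misses A x s Z"
proof -
  obtain n where n: "\<And>z. z \<in> below Y \<Longrightarrow> vsupp e (z 0) \<subseteq> {n..} \<Longrightarrow> x \<frown> z \<notin> A s"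
    using assms(1) by (auto simp: misses_def)
  obtain k where k: "\<And>v. v \<in> span (range Z) \<Longrightarrow> vsupp e v \<subseteq> {k..} \<Longrightarrow> v \<in> span (range Y)"
    using assms(3) by (auto simp: almost_sub_def)
  have "x \<frown> z \<notin> A s" if z: "z \<in> below Z" and z0: "vsupp e (z 0) \<subseteq> {max n k..}" for z
  proof (rule n)
    have zb: "block_seq e z" using z by (simp add: below_iff block_seqs_iff)
    obtain i where i: "i \<in> vsupp e (z 0)"
      using zb vsupp_empty_iff by (fastforce simp: block_seq_def)
    have "vsupp e (z m) \<subseteq> {k..}" for m
    proof (cases "m = 0")
      case False
      then show ?thesis using block_seqD[OF zb, of 0 m i] i z0 by fastforce
    qed (use z0 in auto)
    then show "z \<in> below Y"
      using z Y k by (auto simp: below_iff block_seqs_iff)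
    show "vsupp e (z 0) \<subseteq> {n..}" using z0 by auto
  qed
  then show ?thesis unfolding misses_def by blast
qed

text \<open>In the second alternative, \<open>P\<close> collects the pairs from which no thinning
  out leads to missing. The strict increase of length in the target guarantees that reaching it
  takes at least one move.\<close>

lemma souslin_dichotomy:
  fixes A :: "nat list \<Rightarrow> (nat \<Rightarrow> 'a) set"
  assumes U: "U \<in> block_seqs e D"
    and A: "\<And>s. A s \<subseteq> (\<Union>k. A (s @ [k]))"
  shows "\<exists>Z\<in>below U. below Z \<inter> A [] = {} \<or>
    (\<exists>P. ([], []) \<in> P \<and> (\<forall>(x, s)\<in>P. (\<exists>z. x \<frown> z \<in> A s) \<and>
       forced Z {x'. length x < length x' \<and> (\<exists>k. (x', s @ [k]) \<in> P)} x))"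
proof -
  let ?I = "lists D \<times> (UNIV :: nat list set)"
  have cI: "countable ?I"
    using countable_D by (intro countable_SIGMA countable_lists) auto
  have "\<exists>Y\<in>below U. \<forall>p\<in>?I. (case p of (x, s) \<Rightarrow> misses A x s) Y \<or>
      (\<forall>X\<in>block_seqs e D. X \<sqsubseteq> Y \<longrightarrow> \<not> (case p of (x, s) \<Rightarrow> misses A x s) X)"
    by (rule decide[OF cI U]) (auto intro: misses_almost_sub)
  then obtain Y where YU: "Y \<in> below U"
    and Y: "\<And>x s X. x \<in> lists D \<Longrightarrow> \<not> misses A x s Y \<Longrightarrow> X \<in> block_seqs e D \<Longrightarrow> X \<sqsubseteq> Y
      \<Longrightarrow> \<not> misses A x s X"
    by fastforce
  have YB: "Y \<in> block_seqs e D" using YU by (rule below_block_seqs)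
  \<comment> \<open>\<open>P\<close> refers to the fixed \<open>Y\<close>, so the targets
    \<open>T x s\<close> stay the same under further thinning and \<open>forced_almost_sub\<close>
    gives heredity.\<close>
  define P where "P = {(x, s). x \<in> lists D \<and> \<not> misses A x s Y}"
  define T where "T x s = {x'. length x < length x' \<and> (\<exists>k. (x', s @ [k]) \<in> P)}" for x :: "'a list" and s
  show ?thesis
  proof (cases "([], []) \<in> P")
    case False
    then obtain n where n: "\<And>z. z \<in> below Y \<Longrightarrow> vsupp e (z 0) \<subseteq> {n..} \<Longrightarrow> z \<notin> A []"
      by (auto simp: P_def misses_def)
    have "z \<notin> A []" if "z \<in> below (suffix n Y)" for z
      using n below_trans[OF that suffix_below[OF YB]] below_ge[OF that] YB by (simp add: block_seqs_iff)
    then show ?thesis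
      using below_trans[OF suffix_below[OF YB] YU] by blast
  next
    case True
    have "\<exists>Z\<in>below Y. \<forall>p\<in>P. (case p of (x, s) \<Rightarrow> forced Z (T x s) x)"
    proof (rule diagonalize[OF _ YB])
      show "countable P" by (rule countable_subset[OF _ cI]) (auto simp: P_def)
    next
      fix p X assume "p \<in> P" and X: "X \<in> below Y"
      then obtain x s where p: "p = (x, s)" "(x, s) \<in> P" by (cases p) auto
      then have x: "x \<in> lists D" and nm: "\<not> misses A x s Y" by (auto simp: P_def)
      obtain Z where ZX: "Z \<in> below X"
        and Z: "forced Z (T x s) x \<or> (\<forall>z\<in>below Z. \<forall>m. x @ prefix m z \<notin> T x s)"
        using forced_or_avoids[OF below_block_seqs[OF X] x] by blast
      have "forced Z (T x s) x"
      proof (rule ccontr)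
        assume "\<not> forced Z (T x s) x"
        then have avoid: "x @ prefix m z \<notin> T x s" if "z \<in> below Z" for z m
          using Z that by blast
        \<comment> \<open>A threshold witnessing that \<open>Y\<close> misses
          \<open>A (s @ [k])\<close> from \<open>x'\<close>, and an arbitrary number if there is
          none.\<close>
        define \<nu> where "\<nu> x' k = (SOME n. \<forall>z\<in>below Y. vsupp e (z 0) \<subseteq> {n..} \<longrightarrow> x' \<frown> z \<notin> A (s @ [k]))"
          for x' k
        \<comment> \<open>Only digits \<open>k\<close> up to the length of \<open>l\<close> are
          considered, which keeps the maximum finite; every \<open>k\<close> is covered once
          \<open>l\<close> is long enough.\<close>
        define h where "h l = Max ((\<lambda>k. \<nu> (x @ l) k) ` {..length l})" for l
        have h: "\<nu> (x @ l) k \<le> h l" if "k \<le> length l" for k l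
          using that by (simp add: h_def)
        obtain V where VZ: "V \<in> below Z"
          and V: "\<And>z m. z \<in> below V \<Longrightarrow> vsupp e (z m) \<subseteq> {h (prefix m z)..}"
          using sparse_subsequence[OF below_block_seqs[OF ZX]] by blast
        have VY: "V \<in> below Y" using VZ ZX X below_trans by blast
        have "x \<frown> z \<notin> A s" if z: "z \<in> below V" for z
        proof
          assume "x \<frown> z \<in> A s"
          then obtain k where k: "x \<frown> z \<in> A (s @ [k])" using A by blast
          \<comment> \<open>The length \<open>Suc k\<close> lets \<open>h\<close> account for
            \<open>k\<close> and makes \<open>?x'\<close> strictly longer than \<open>x\<close>, so
            that avoiding \<open>T x s\<close> means that no pair \<open>(?x', s @ [k])\<close> is
            in \<open>P\<close>.\<close>
          let ?x' = "x @ prefix (Suc k) z"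
          have zB: "z \<in> block_seqs e D" using z by (rule below_block_seqs)
          then have "?x' \<in> lists D"
            using x by (auto simp: subsequence_def block_seqs_def)
          moreover have "?x' \<notin> T x s" by (rule avoid[OF below_trans[OF z VZ]])
          ultimately have "misses A ?x' (s @ [k]) Y"
            by (auto simp: T_def P_def)
          then have miss: "\<forall>y\<in>below Y. vsupp e (y 0) \<subseteq> {\<nu> ?x' k..} \<longrightarrow> ?x' \<frown> y \<notin> A (s @ [k])"
            unfolding misses_def \<nu>_def by (rule someI_ex)
          have tail: "suffix (Suc k) z \<in> below Y"
            using suffix_below[OF zB] z VY below_trans by blast
          have "vsupp e (suffix (Suc k) z 0) \<subseteq> {\<nu> ?x' k..}"
            using V[OF z, of "Suc k"] h[of k "prefix (Suc k) z"] by fastforce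
          then have "?x' \<frown> suffix (Suc k) z \<notin> A (s @ [k])"
            using miss tail by blast
          moreover have "?x' \<frown> suffix (Suc k) z = x \<frown> z"
            by (metis conc_conc prefix_suffix)
          ultimately show False using k by metis
        qed
        then have "misses A x s V" by (auto simp: misses_def)
        then show False
          using Y[OF x nm below_block_seqs[OF VY] below_imp_almost_sub[OF VY]] by blast
      qed
      then show "\<exists>Z\<in>below X. case p of (x, s) \<Rightarrow> forced Z (T x s) x"
        using ZX p by auto
    qed (auto intro: forced_almost_sub)
    then obtain Z where ZY: "Z \<in> below Y" and Z: "\<And>x s. (x, s) \<in> P \<Longrightarrow> forced Z (T x s) x"
      by auto
    have "\<exists>z. x \<frown> z \<in> A s" if "(x, s) \<in> P" for x s
      using that by (auto simp: P_def misses_def)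
    then show ?thesis
      using True Z below_trans[OF ZY YU] unfolding T_def by blast
  qed
qed

section \<open>Strategies of player II from forced positions\<close>

text \<open>Induction on \<open>forced\<close>: the first answer is chosen by the
  \<open>move\<close> rule, and the strategy obtained for the resulting position takes over.\<close>

lemma forced_strategy:
  assumes "forced Z T x"
  shows "\<exists>\<tau>. gowers_II_strategy e D Z \<tau> \<and>
    (\<forall>W. (\<forall>n. W n \<in> below Z) \<longrightarrow> (\<exists>m. x @ prefix m (gowers_II_outcome \<tau> W) \<in> T))"
  using assms
proof induction
  case (reached x)
  \<comment> \<open>The target is already reached, so any legal answers will do.\<close>
  have "gowers_II_strategy e D Z (\<lambda>Ws. last Ws 0)"
    unfolding gowers_II_strategy_def
  proof (intro allI impI)
    fix Ws assume Ws: "Ws \<noteq> [] \<and> set Ws \<subseteq> below Z"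
    then have "last Ws \<in> below Z" using last_in_set by blast
    then show "last Ws 0 \<in> span (range (last Ws)) \<inter> D"
      by (auto simp: below_iff block_seqs_def span_base)
  qed
  moreover have "x @ prefix 0 w \<in> T" for w
    using reached by (simp add: subsequence_def)
  ultimately show ?case by blast
next
  case (move x)
  then obtain y \<tau> where y: "\<And>W. W \<in> below Z \<Longrightarrow> y W \<in> span (range W) \<inter> D"
    and \<tau>: "\<And>W. W \<in> below Z \<Longrightarrow> gowers_II_strategy e D Z (\<tau> W)"
    and \<tau>_wins: "\<And>W V. W \<in> below Z \<Longrightarrow> \<forall>n. V n \<in> below Z \<Longrightarrow>
      \<exists>m. (x @ [y W]) @ prefix m (gowers_II_outcome (\<tau> W) V) \<in> T"
    by metis
  define \<sigma> where "\<sigma> Ws = (if tl Ws = [] then y (hd Ws) else \<tau> (hd Ws) (tl Ws))" for Ws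
  have "gowers_II_strategy e D Z \<sigma>"
    unfolding gowers_II_strategy_def
  proof (intro allI impI)
    fix Ws assume "Ws \<noteq> [] \<and> set Ws \<subseteq> below Z"
    then obtain W Vs where "Ws = W # Vs" "W \<in> below Z" "set Vs \<subseteq> below Z"
      by (cases Ws) auto
    then show "\<sigma> Ws \<in> span (range (last Ws)) \<inter> D"
      using y \<tau> unfolding \<sigma>_def gowers_II_strategy_def by auto
  qed
  moreover have "\<exists>m. x @ prefix m (gowers_II_outcome \<sigma> W) \<in> T" if W: "\<forall>n. W n \<in> below Z" for W
  proof -
    have "gowers_II_outcome (\<lambda>Ws. \<sigma> (W 0 # Ws)) V = gowers_II_outcome (\<tau> (W 0)) V" for V
      by (simp add: gowers_II_outcome_def \<sigma>_def)
    then have "prefix (Suc m) (gowers_II_outcome \<sigma> W) =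
        y (W 0) # prefix m (gowers_II_outcome (\<tau> (W 0)) (suffix 1 W))" for m
      unfolding prefix_Suc_outcome by (simp add: \<sigma>_def)
    moreover obtain m where "(x @ [y (W 0)]) @ prefix m (gowers_II_outcome (\<tau> (W 0)) (suffix 1 W)) \<in> T"
      using \<tau>_wins[of "W 0" "suffix 1 W"] W by auto
    ultimately have "x @ prefix (Suc m) (gowers_II_outcome \<sigma> W) \<in> T" by simp
    then show ?thesis by blast
  qed
  ultimately show ?case by blast
qed

text \<open>Player II repeatedly follows the strategies of the preceding lemma, switching to a new one
  whenever the old one has reached its target.\<close>

lemma forced_concat:
  assumes P0: "([], []) \<in> P"
    and P: "\<And>x s. (x, s) \<in> P \<Longrightarrow>
      forced Z {x'. length x < length x' \<and> (\<exists>k. (x', s @ [k]) \<in> P)} x"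
  shows "\<exists>\<sigma>. gowers_II_strategy e D Z \<sigma> \<and> (\<forall>W. (\<forall>n. W n \<in> below Z) \<longrightarrow>
    (\<exists>\<alpha> N. \<forall>i. i \<le> N i \<and> (prefix (N i) (gowers_II_outcome \<sigma> W), prefix i \<alpha>) \<in> P))"
proof -
  \<comment> \<open>A strategy is live if, against every play, it reaches \<open>P\<close> with one
    more digit after at least one further move.\<close>
  define live where "live x s \<tau> \<longleftrightarrow> gowers_II_strategy e D Z \<tau> \<and>
    (\<forall>W. (\<forall>n. W n \<in> below Z) \<longrightarrow>
      (\<exists>m>0. \<exists>k. (x @ prefix m (gowers_II_outcome \<tau> W), s @ [k]) \<in> P))" for x s \<tau>
  have "\<exists>\<tau>. live x s \<tau>" if xs: "(x, s) \<in> P" for x s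
  proof -
    let ?T = "{x'. length x < length x' \<and> (\<exists>k. (x', s @ [k]) \<in> P)}"
    obtain \<tau> where \<tau>: "gowers_II_strategy e D Z \<tau>"
      "\<And>W. \<forall>n. W n \<in> below Z \<Longrightarrow> \<exists>m. x @ prefix m (gowers_II_outcome \<tau> W) \<in> ?T"
      using forced_strategy[OF P[OF xs]] by blast
    have "\<exists>m>0. \<exists>k. (x @ prefix m (gowers_II_outcome \<tau> W), s @ [k]) \<in> P"
      if "\<forall>n. W n \<in> below Z" for W
      using \<tau>(2)[OF that] by auto
    then show ?thesis using \<tau>(1) unfolding live_def by blast
  qed
  then obtain \<tau> where \<tau>: "\<And>x s. (x, s) \<in> P \<Longrightarrow> live x s (\<tau> x s)" by metis
  \<comment> \<open>A state consists of the position \<open>x\<close>, the digits \<open>s\<close>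
    found so far and a continuation strategy \<open>\<rho>\<close> that sees only the moves still to
    come. When a further digit becomes available, a fresh strategy is started; otherwise the move is
    absorbed into the history of \<open>\<rho>\<close>.\<close>
  define step where "step = (\<lambda>(x, s, \<rho>) W.
    let x' = x @ [\<rho> [W]]; s' = s @ [SOME k. (x', s @ [k]) \<in> P]
    in if (x', s') \<in> P then (x', s', \<tau> x' s') else (x', s, \<lambda>Ws. \<rho> (W # Ws)))"
  define run where "run = foldl step ([], [], \<tau> [] [])"
  have step_new: "\<exists>k. (x @ [\<rho> [W]], s @ [k]) \<in> P \<and>
      step (x, s, \<rho>) W = (x @ [\<rho> [W]], s @ [k], \<tau> (x @ [\<rho> [W]]) (s @ [k]))"
    if "(x @ [\<rho> [W]], s @ [k]) \<in> P" for x s \<rho> W k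
    using someI[of "\<lambda>k. (x @ [\<rho> [W]], s @ [k]) \<in> P", OF that]
    by (auto simp: step_def Let_def)
  have step_old: "step (x, s, \<rho>) W = (x @ [\<rho> [W]], s, \<lambda>Ws. \<rho> (W # Ws))"
    if "\<nexists>k. (x @ [\<rho> [W]], s @ [k]) \<in> P" for x s \<rho> W
    using that by (auto simp: step_def Let_def)
  have fst_step: "fst (step (x, s, \<rho>) W) = x @ [\<rho> [W]]" for x s \<rho> W
    by (simp add: step_def Let_def)
  have live_step: "(case step (x, s, \<rho>) W of (x, s, \<rho>) \<Rightarrow> live x s \<rho>)"
    if live: "live x s \<rho>" and W: "W \<in> below Z" for x s \<rho> W
  proof (cases "\<exists>k. (x @ [\<rho> [W]], s @ [k]) \<in> P")
    case True
    then show ?thesis using step_new \<tau> by fastforce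
  next
    case False
    let ?\<rho> = "\<lambda>Ws. \<rho> (W # Ws)"
    have "gowers_II_strategy e D Z ?\<rho>"
      using live W unfolding live_def gowers_II_strategy_def by (metis insert_subset last_ConsR list.discI list.simps(15))
    moreover have "\<exists>m>0. \<exists>k. ((x @ [\<rho> [W]]) @ prefix m (gowers_II_outcome ?\<rho> V), s @ [k]) \<in> P"
      if V: "\<forall>n. V n \<in> below Z" for V
    proof -
      let ?V = "[W] \<frown> V"
      have "\<forall>n. ?V n \<in> below Z" using V W by (simp add: conc_def)
      then obtain m k where m: "m > 0" "(x @ prefix m (gowers_II_outcome \<rho> ?V), s @ [k]) \<in> P"
        using live unfolding live_def by blast
      then obtain m' where m': "m = Suc m'" using gr0_implies_Suc by blast
      have "suffix 1 ?V = V" by (simp add: fun_eq_iff conc_def)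
      then have *: "((x @ [\<rho> [W]]) @ prefix m' (gowers_II_outcome ?\<rho> V), s @ [k]) \<in> P"
        using m(2) unfolding m' prefix_Suc_outcome by simp
      \<comment> \<open>If \<open>m'\<close> were zero, the position after this single answer would
        already be in \<open>P\<close> with a new digit.\<close>
      with False have "m' > 0" by (cases m') (auto simp: subsequence_def)
      with * show ?thesis by blast
    qed
    ultimately show ?thesis using step_old[where x = x and s = s and \<rho> = \<rho> and W = W, OF False] by (simp add: live_def)
  qed
  have live_run: "case run Ws of (x, s, \<rho>) \<Rightarrow> live x s \<rho>" if "set Ws \<subseteq> below Z" for Ws
    using that
  proof (induction Ws rule: rev_induct)
    case Nil
    then show ?case using \<tau>[OF P0] by (simp add: run_def)
  next
    case (snoc W Ws)
    obtain x s \<rho> where "run Ws = (x, s, \<rho>)" by (cases "run Ws")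
    then show ?case using snoc live_step[of x s \<rho> W] by (simp add: run_def)
  qed
  define \<sigma> where "\<sigma> Ws = last (fst (run Ws))" for Ws
  have strategy: "gowers_II_strategy e D Z \<sigma>"
    unfolding gowers_II_strategy_def
  proof (intro allI impI)
    fix Ws assume Ws: "Ws \<noteq> [] \<and> set Ws \<subseteq> below Z"
    then obtain Vs W where VW: "Ws = Vs @ [W]" by (metis rev_exhaust)
    obtain x s \<rho> where r: "run Vs = (x, s, \<rho>)" by (cases "run Vs")
    then have "gowers_II_strategy e D Z \<rho>"
      using live_run[of Vs] Ws VW by (simp add: live_def)
    moreover have "[W] \<noteq> [] \<and> set [W] \<subseteq> below Z"
      using Ws VW by simp
    ultimately have "\<rho> [W] \<in> span (range W) \<inter> D"
      unfolding gowers_II_strategy_def by (metis last.simps)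
    moreover have "\<sigma> Ws = \<rho> [W]"
      using r by (simp add: \<sigma>_def VW run_def fst_step)
    ultimately show "\<sigma> Ws \<in> span (range (last Ws)) \<inter> D" by (simp add: VW)
  qed
  \<comment> \<open>The run switches at the first opportunity, possibly before the given
    \<open>m\<close> and with another digit, hence the fresh existential quantifiers.\<close>
  have progress: "\<exists>m>0. \<exists>x' k \<rho>'. (x', s @ [k]) \<in> P \<and> foldl step (x, s, \<rho>) (prefix m W) = (x', s @ [k], \<rho>')"
    if "(x @ prefix m (gowers_II_outcome \<rho> W), s @ [k]) \<in> P" "m > 0" for x s \<rho> W m k
    using that
  proof (induction m arbitrary: x \<rho> W)
    case (Suc m)
    show ?case
    proof (cases "\<exists>k. (x @ [\<rho> [W 0]], s @ [k]) \<in> P")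
      case True
      then obtain k where "(x @ [\<rho> [W 0]], s @ [k]) \<in> P"
        "step (x, s, \<rho>) (W 0) = (x @ [\<rho> [W 0]], s @ [k], \<tau> (x @ [\<rho> [W 0]]) (s @ [k]))"
        using step_new by blast
      then show ?thesis by (intro exI[of _ 1]) (simp add: subsequence_def)
    next
      case False
      have *: "((x @ [\<rho> [W 0]]) @ prefix m (gowers_II_outcome (\<lambda>Ws. \<rho> (W 0 # Ws)) (suffix 1 W)), s @ [k]) \<in> P"
        using Suc.prems(1) unfolding prefix_Suc_outcome by simp
      with False have "m > 0" by (cases m) (auto simp: subsequence_def)
      from Suc.IH[OF * this] obtain m' x' k \<rho>' where "(x', s @ [k]) \<in> P"
        and m': "foldl step (x @ [\<rho> [W 0]], s, \<lambda>Ws. \<rho> (W 0 # Ws)) (prefix m' (suffix 1 W)) = (x', s @ [k], \<rho>')"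
        by blast
      moreover have "prefix (Suc m') W = W 0 # prefix m' (suffix 1 W)"
        by (simp add: subsequence_def map_upt_Suc suffix_def del: upt_Suc)
      then have "foldl step (x, s, \<rho>) (prefix (Suc m') W) = (x', s @ [k], \<rho>')"
        using m' step_old[where x = x and s = s and \<rho> = \<rho> and W = "W 0", OF False] by simp
      ultimately show ?thesis by blast
    qed
  qed simp
  have "\<exists>\<alpha> N. \<forall>i. i \<le> N i \<and> (prefix (N i) (gowers_II_outcome \<sigma> W), prefix i \<alpha>) \<in> P"
    if W: "\<forall>n. W n \<in> below Z" for W
  proof -
    define x s \<rho> where "x n = fst (run (prefix n W))" and "s n = fst (snd (run (prefix n W)))"
      and "\<rho> n = snd (snd (run (prefix n W)))" for n
    have run: "run (prefix n W) = (x n, s n, \<rho> n)" for n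
      by (simp add: x_def s_def \<rho>_def)
    have run_Suc: "run (prefix (Suc n) W) = step (x n, s n, \<rho> n) (W n)" for n
      using run[of n] by (simp add: subsequence_def run_def)
    have x: "x n = prefix n (gowers_II_outcome \<sigma> W)" for n
    proof (induction n)
      case 0
      then show ?case by (simp add: x_def run_def subsequence_def)
    next
      case (Suc n)
      have "x (Suc n) = x n @ [\<rho> n [W n]]"
        using run_Suc[of n] fst_step by (simp add: x_def)
      moreover from this have "gowers_II_outcome \<sigma> W n = \<rho> n [W n]"
        by (simp add: gowers_II_outcome_def \<sigma>_def x_def subsequence_def)
      ultimately show ?case using Suc by (simp add: subsequence_def)
    qed
    have nxt: "\<exists>n'>n. \<exists>k. (x n', s n') \<in> P \<and> s n' = s n @ [k]" for n
    proof -
      have "live (x n) (s n) (\<rho> n)"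
        using live_run[of "prefix n W"] W run by (auto simp: subsequence_def)
      moreover have "\<forall>i. suffix n W i \<in> below Z" using W by simp
      ultimately obtain m k where "m > 0"
        "(x n @ prefix m (gowers_II_outcome (\<rho> n) (suffix n W)), s n @ [k]) \<in> P"
        unfolding live_def by blast
      then obtain m x' k \<rho>' where m: "m > 0" "(x', s n @ [k]) \<in> P"
        "foldl step (x n, s n, \<rho> n) (prefix m (suffix n W)) = (x', s n @ [k], \<rho>')"
        using progress[of "x n" "\<rho> n" "suffix n W" m "s n" k] by blast
      have "prefix (n + m) W = prefix n W @ prefix m (suffix n W)"
        by (intro nth_equalityI) (auto simp: subsequence_def nth_append)
      then have "run (prefix (n + m) W) = (x', s n @ [k], \<rho>')"
        using m(3) run[of n] by (simp add: run_def)
      then have "x (n + m) = x'" "s (n + m) = s n @ [k]"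
        using run[of "n + m"] by simp_all
      then show ?thesis using m by (intro exI[of _ "n + m"]) auto
    qed
    have s0: "s 0 = []" "x 0 = []" by (simp_all add: s_def x_def run_def subsequence_def)
    \<comment> \<open>\<open>N\<close> lists successive times at which a digit is appended. The
      clause for \<open>i = 0\<close> fixes the start, where no digit has been found yet.\<close>
    have "\<exists>N. \<forall>i. ((x (N i), s (N i)) \<in> P \<and> (i = 0 \<longrightarrow> N i = 0)) \<and>
        (N i < N (Suc i) \<and> (\<exists>k. s (N (Suc i)) = s (N i) @ [k]))"
    proof (rule dependent_nat_choice)
      show "\<exists>n. (x n, s n) \<in> P \<and> (0 = (0::nat) \<longrightarrow> n = 0)"
        using P0 s0 by auto
      show "\<exists>n'. ((x n', s n') \<in> P \<and> (Suc i = 0 \<longrightarrow> n' = 0)) \<and> n < n' \<and> (\<exists>k. s n' = s n @ [k])"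
        for n i :: nat
        using nxt[of n] by auto
    qed
    then obtain N where NP: "\<And>i. (x (N i), s (N i)) \<in> P" and N0: "N 0 = 0"
      and N: "\<And>i. N i < N (Suc i)" and "\<forall>i. \<exists>k. s (N (Suc i)) = s (N i) @ [k]"
      by blast
    then obtain \<alpha> where \<alpha>: "\<And>i. s (N (Suc i)) = s (N i) @ [\<alpha> i]" by metis
    have "s (N i) = prefix i \<alpha>" for i
      by (induction i) (simp_all add: N0 s0 \<alpha> subsequence_def)
    moreover have "i \<le> N i" for i
      using N by (intro strict_mono_imp_increasing) (simp add: strict_mono_Suc_iff)
    ultimately show ?thesis using NP x by metis
  qed
  then show ?thesis using strategy by blast
qed

end

section \<open>The dichotomy for analytic sets\<close>

theorem theorem1:
  fixes e :: "nat \<Rightarrow> 'a::real_vector" and D :: "'a set" and G :: "(nat \<Rightarrow> 'a) set"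
  assumes basis: "inj e" "independent (range e)" "span (range e) = UNIV"
    and D1: "\<And>n. D \<inter> span (e ` {n..}) \<noteq> {}"
    and D2: "\<And>n. finite (D \<inter> span (e ` {..<n}))"
    and G_sub: "G \<subseteq> block_seqs e D"
    and G_analytic: "analytic_in (seq_topology D) G"
  shows "\<forall>U \<in> block_seqs e D. \<exists>Z \<in> block_seqs_below e D U.
           block_seqs_below e D Z \<inter> G = {} \<or> gowers_II_wins e D Z G"
proof
  fix U assume U: "U \<in> block_seqs e D"
  interpret gowers_space e D
    using basis D2 by unfold_locales
  show "\<exists>Z\<in>below U. below Z \<inter> G = {} \<or> gowers_II_wins e D Z G"
  proof (cases "G = {}")
    case True
    then show ?thesis using below_refl[OF U] by blast
  next
    case False
    then obtain f where f: "continuous_map baire_space (seq_topology D) f" "range f = G"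
      using G_analytic by (auto simp: analytic_in_def baire_space_def)
    \<comment> \<open>The Souslin scheme of the parametrization: images of the basic open sets of
      the Baire space.\<close>
    define A where "A s = f ` {\<alpha>. prefix (length s) \<alpha> = s}" for s
    have "A s \<subseteq> (\<Union>k. A (s @ [k]))" for s
    proof
      fix w assume "w \<in> A s"
      then obtain \<alpha> where "prefix (length s) \<alpha> = s" "w = f \<alpha>" by (auto simp: A_def)
      then have "w \<in> A (s @ [\<alpha> (length s)])" by (simp add: A_def subsequence_def)
      then show "w \<in> (\<Union>k. A (s @ [k]))" by blast
    qed
    from souslin_dichotomy[where A = A, OF U this] obtain Z where ZU: "Z \<in> below U"
      and Z: "below Z \<inter> A [] = {} \<or>
        (\<exists>P. ([], []) \<in> P \<and> (\<forall>(x, s)\<in>P. (\<exists>z. x \<frown> z \<in> A s) \<and>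
          forced Z {x'. length x < length x' \<and> (\<exists>k. (x', s @ [k]) \<in> P)} x))"
      by blast
    have A0: "A [] = G" using f(2) by (simp add: A_def subsequence_def)
    have "gowers_II_wins e D Z G" if "below Z \<inter> G \<noteq> {}"
    proof -
      have "\<exists>P. ([], []) \<in> P \<and> (\<forall>(x, s)\<in>P. (\<exists>z. x \<frown> z \<in> A s) \<and>
          forced Z {x'. length x < length x' \<and> (\<exists>k. (x', s @ [k]) \<in> P)} x)"
        using Z that unfolding A0 by argo
      then obtain P where P0: "([], []) \<in> P"
        and P: "\<forall>(x, s)\<in>P. (\<exists>z. x \<frown> z \<in> A s) \<and>
          forced Z {x'. length x < length x' \<and> (\<exists>k. (x', s @ [k]) \<in> P)} x"
        by (elim exE conjE)
      have PA: "\<exists>z. x \<frown> z \<in> A s"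
        and PF: "forced Z {x'. length x < length x' \<and> (\<exists>k. (x', s @ [k]) \<in> P)} x"
        if "(x, s) \<in> P" for x s
        using bspec[OF P that] by simp_all
      obtain \<sigma> where \<sigma>: "gowers_II_strategy e D Z \<sigma>"
        and \<sigma>P: "\<And>W. \<forall>n. W n \<in> below Z \<Longrightarrow>
          \<exists>\<alpha> N. \<forall>i. i \<le> N i \<and> (prefix (N i) (gowers_II_outcome \<sigma> W), prefix i \<alpha>) \<in> P"
        using forced_concat[OF P0 PF] by blast
      have "gowers_II_outcome \<sigma> W \<in> G" if W: "\<forall>n. W n \<in> below Z" for W
      proof -
        let ?w = "gowers_II_outcome \<sigma> W"
        obtain \<alpha> N where N: "\<And>i. i \<le> N i" "\<And>i. (prefix (N i) ?w, prefix i \<alpha>) \<in> P"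
          using \<sigma>P[OF W] by blast
        have "f \<alpha> i = ?w i" for i
        proof -
          obtain j where j: "\<And>\<beta>. prefix j \<beta> = prefix j \<alpha> \<Longrightarrow> f \<beta> i = f \<alpha> i"
            using continuous_baire_seq[OF f(1)] by blast
          \<comment> \<open>Agreement up to \<open>j\<close> fixes the \<open>i\<close>-th
            coordinate of \<open>f\<close>. The bound \<open>Suc i\<close> together with
            \<open>?m \<le> N ?m\<close> puts index \<open>i\<close> inside the known prefix of the
            outcome.\<close>
          let ?m = "max j (Suc i)"
          obtain z where "prefix (N ?m) ?w \<frown> z \<in> A (prefix ?m \<alpha>)"
            using PA[OF N(2)] by blast
          then obtain \<beta> where \<beta>: "prefix ?m \<beta> = prefix ?m \<alpha>" "f \<beta> = prefix (N ?m) ?w \<frown> z"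
            by (auto simp: A_def)
          have "f \<beta> i = f \<alpha> i"
            using \<beta>(1) by (intro j) (simp add: subsequence_def)
          moreover have "f \<beta> i = ?w i"
            using N(1)[of ?m] by (simp add: \<beta>(2) subsequence_def)
          ultimately show ?thesis by simp
        qed
        then have "f \<alpha> = ?w" by blast
        then show ?thesis using f(2) by (metis rangeI)
      qed
      then show ?thesis using \<sigma> unfolding gowers_II_wins_def by blast
    qed
    then show ?thesis using ZU by blast
  qed
qed

end
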